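(* In the setting described in the context (combined jump Markov rates on $\mathcal Z\times\mathbb X$ built from $\tau^{(x)}$, $Q^{(z)}$, $m$, $\alpha$, $\sigma$): (I) The density $$\kappa(z,x)=\frac{m(z,x)}{\sigma(z)}$$ (with respect to $\upsilon\times\gamma$) and the kernel $R$ satisfy the weak invariance equation (WIE) on $\mathcal Z\times\mathbb X$. (II) If $\Xi=\int_{\mathcal Z\times\mathbb X}\kappa(z,x)\,d\upsilon(z)\,d\gamma(x)<\infty$, then the probability density $\pi(z,x)=\kappa(z,x)/\Xi$ (with respect to $\upsilon\times\gamma$) also satisfies the WIE with the kernel $R$.
   Context: $(\mathcal Z,\upsilon)$ and $(\mathbb X,\gamma)$ are standard ($\sigma$-finite, nonzero) measure spaces; all functions below are jointly measurable. For each $x\in\mathbb X$ a kernel $\tau^{(x)}(z,z')\ge0$, $z,z'\in\mathcal Z$, is given, and for each $z\in\mathcal Z$ a kernel $Q^{(z)}(x,x')\ge0$ and a function $m(z,x)>0$, $x,x'\in\mathbb X$, with $\tau^{(x)}(z,z)=Q^{(z)}(x,x)=0$, such that for $(\upsilon\times\gamma)$-a.a. $(z,x)$ $$\int_{\mathcal Z}\tau^{(x)}(z,z')\,d\upsilon(z')=\int_{\mathcal Z}\tau^{(x)}(z',z)\,d\upsilon(z'),$$ $$m(z,x)\int_{\mathbb X}Q^{(z)}(x,y)\,d\gamma(y)=\int_{\mathbb X}m(z,y)Q^{(z)}(y,x)\,d\gamma(y).$$ Thus $m(z,\cdot)$ is the density $d\nu^{(z)}/d\gamma$ of an invariant measure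 $\nu^{(z)}$ for the rates $Q^{(z)}$. Functions $\alpha(z)\ge0$ and $\sigma(z)>0$ on $\mathcal Z$ are given. The combined rates are $$R[(z,x),(z,x')]=\alpha(z)Q^{(z)}(x,x'),\qquad R[(z,x),(z',x)]=\sigma(z)\frac{\tau^{(x)}(z,z')}{m(z,x)},$$ where rates of the first type (jumps in $x$ with $z$ fixed) are densities in $x'$ relative to $\gamma$ and rates of the second type (jumps in $z$ with $x$ fixed) are densities in $z'$ relative to $\upsilon$; no other jumps occur. A density $\eta(z,x)\ge0$ relative to $\upsilon\times\gamma$ and the kernel $R$ satisfy the WIE if for $(\upsilon\times\gamma)$-a.a. $(z,x)$ $$\eta(z,x)\Big[\int_{\mathbb X}R[(z,x),(z,x')]\,d\gamma(x')+\int_{\mathcal Z}R[(z,x),(z',x)]\,d\upsilon(z')\Big]$$ $$=\int_{\mathbb X}\eta(z,x')R[(z,x'),(z,x)]\,d\gamma(x')+\int_{\mathcal Z}\eta(z',x)R[(z',x),(z,x)]\,d\upsilon(z').$$ Integrals of nonnegative functions are understood in $[0,\infty]$. *)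

theory Defs
  imports "HOL-Analysis.Analysis"
begin

text \<open>
  Arguments follow the order superscript, source, target: \<open>\<tau> x z z'\<close> stands for
  \<open>\<tau>\<^sup>(\<^sup>x\<^sup>)(z,z')\<close> and \<open>Q z x x'\<close> for \<open>Q\<^sup>(\<^sup>z\<^sup>)(x,x')\<close>.

  The combined kernel is one function of two states of the product space. On the diagonal both types
  of jump have rate zero, provided that \<open>\<tau> x z z = 0\<close> and \<open>Q z x x = 0\<close>, so the order of the case
  distinctions is immaterial. \<open>R (z, x) (z, x')\<close> is a density in \<open>x'\<close> with respect to the measure on
  the second component; \<open>R (z, x) (z', x)\<close> is a density in \<open>z'\<close> with respect to the measure on the
  first.
\<close>

definition combined_rates ::
    "('x \<Rightarrow> 'z \<Rightarrow> 'z \<Rightarrow> real) \<Rightarrow> ('z \<Rightarrow> 'x \<Rightarrow> 'x \<Rightarrow> real) \<Rightarrow> ('z \<Rightarrow> 'x \<Rightarrow> real) \<Rightarrow>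
     ('z \<Rightarrow> real) \<Rightarrow> ('z \<Rightarrow> real) \<Rightarrow> 'z \<times> 'x \<Rightarrow> 'z \<times> 'x \<Rightarrow> real" where
  "combined_rates \<tau> Q m \<alpha> \<sigma> = (\<lambda>(z, x) (z', x').
     if z' = z then \<alpha> z * Q z x x'
     else if x' = x then \<sigma> z * (\<tau> x z z' / m z x)
     else 0)"

definition density_on :: "'a measure \<Rightarrow> ('a \<Rightarrow> real) \<Rightarrow> bool" where
  "density_on M \<eta> \<longleftrightarrow> \<eta> \<in> borel_measurable M \<and> (\<forall>p\<in>space M. 0 \<le> \<eta> p)"

definition probability_density_on :: "'a measure \<Rightarrow> ('a \<Rightarrow> real) \<Rightarrow> bool" where
  "probability_density_on M \<eta> \<longleftrightarrow> density_on M \<eta> \<and> (\<integral>\<^sup>+ p. ennreal (\<eta> p) \<partial>M) = 1"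

definition satisfies_WIE ::
    "'z measure \<Rightarrow> 'x measure \<Rightarrow> ('z \<times> 'x \<Rightarrow> real) \<Rightarrow> ('z \<times> 'x \<Rightarrow> 'z \<times> 'x \<Rightarrow> real) \<Rightarrow> bool" where
  "satisfies_WIE \<upsilon> \<gamma> \<eta> R \<longleftrightarrow>
     density_on (\<upsilon> \<Otimes>\<^sub>M \<gamma>) \<eta> \<and>
     (AE (z, x) in \<upsilon> \<Otimes>\<^sub>M \<gamma>.
        ennreal (\<eta> (z, x)) *
          ((\<integral>\<^sup>+ x'. ennreal (R (z, x) (z, x')) \<partial>\<gamma>) + (\<integral>\<^sup>+ z'. ennreal (R (z, x) (z', x)) \<partial>\<upsilon>))
        = (\<integral>\<^sup>+ x'. ennreal (\<eta> (z, x') * R (z, x') (z, x)) \<partial>\<gamma>)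
          + (\<integral>\<^sup>+ z'. ennreal (\<eta> (z', x) * R (z', x) (z, x)) \<partial>\<upsilon>))"

definition kappa :: "('z \<Rightarrow> 'x \<Rightarrow> real) \<Rightarrow> ('z \<Rightarrow> real) \<Rightarrow> 'z \<times> 'x \<Rightarrow> real" where
  "kappa m \<sigma> = (\<lambda>(z, x). m z x / \<sigma> z)"

definition Xi ::
    "'z measure \<Rightarrow> 'x measure \<Rightarrow> ('z \<Rightarrow> 'x \<Rightarrow> real) \<Rightarrow> ('z \<Rightarrow> real) \<Rightarrow> ennreal" where
  "Xi \<upsilon> \<gamma> m \<sigma> = (\<integral>\<^sup>+ p. ennreal (kappa m \<sigma> p) \<partial>(\<upsilon> \<Otimes>\<^sub>M \<gamma>))"

end

theory Submission
  imports Defs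
begin

text \<open>
  The factors \<open>m(z,x)\<close> and \<open>\<sigma>(z)\<close> in \<open>\<kappa>\<close> cancel against those of the \<open>z\<close>-jump rates, so
  the probability flux of \<open>z\<close>-jumps is \<open>\<tau>\<^sup>(\<^sup>x\<^sup>)(z,z')\<close>, balanced at fixed \<open>x\<close>. The flux of \<open>x\<close>-jumps
  is \<open>\<alpha>(z)/\<sigma>(z)\<close> times \<open>m(z,x) Q\<^sup>(\<^sup>z\<^sup>)(x,x')\<close>, balanced at fixed \<open>z\<close>. The two kinds of jump
  therefore balance separately, for \<open>\<kappa>\<close> and for all of its nonnegative multiples.
\<close>

text \<open>The factors \<open>a\<close> and \<open>s\<close> do not vary with \<open>y\<close>, so
  the flux balance is the invariance relation \<open>bal\<close> multiplied by the constant
  \<open>c * a / s\<close>. In the application \<open>z\<close> is frozen, \<open>k\<close> is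
  \<open>m z x\<close>, \<open>\<mu>\<close> is \<open>m z\<close>, and \<open>q\<close>,
  \<open>r\<close> are the rates out of and into \<open>x\<close>.\<close>

lemma balance_in_x:
  fixes q r \<mu> :: "'x \<Rightarrow> real"
  assumes [measurable]: "q \<in> borel_measurable M" "r \<in> borel_measurable M" "\<mu> \<in> borel_measurable M"
    and "0 \<le> a" "0 < s" "0 \<le> c" "0 < k"
    and bal: "ennreal k * (\<integral>\<^sup>+ y. ennreal (q y) \<partial>M) = (\<integral>\<^sup>+ y. ennreal (\<mu> y * r y) \<partial>M)"
  shows "ennreal (c * (k / s)) * (\<integral>\<^sup>+ y. ennreal (a * q y) \<partial>M)
    = (\<integral>\<^sup>+ y. ennreal (c * (\<mu> y / s) * (a * r y)) \<partial>M)"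
proof -
  have "ennreal (c * (k / s)) * (\<integral>\<^sup>+ y. ennreal (a * q y) \<partial>M)
      = ennreal (c * (k / s)) * (ennreal a * (\<integral>\<^sup>+ y. ennreal (q y) \<partial>M))"
    using \<open>0 \<le> a\<close> by (simp add: ennreal_mult' nn_integral_cmult)
  also have "\<dots> = ennreal (c * a / s) * (ennreal k * (\<integral>\<^sup>+ y. ennreal (q y) \<partial>M))"
  proof -
    \<comment> \<open>The aim is to bring \<open>ennreal k\<close> next to the integral, where
      \<open>bal\<close> applies. The integral may be infinite, so only the finite constants are
      rearranged, as real numbers.\<close>
    have "ennreal (c * (k / s)) * ennreal a = ennreal (c * a / s) * ennreal k"
      using assms(4-7) by (simp flip: ennreal_mult' add: field_simps)
    then show ?thesis
      by (simp only: mult.assoc[symmetric])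
  qed
  also have "\<dots> = (\<integral>\<^sup>+ y. ennreal (c * a / s) * ennreal (\<mu> y * r y) \<partial>M)"
    unfolding bal by (simp add: nn_integral_cmult)
  also have "\<dots> = (\<integral>\<^sup>+ y. ennreal (c * (\<mu> y / s) * (a * r y)) \<partial>M)"
    using assms(4-7) by (subst ennreal_mult'[symmetric]) (simp_all add: mult_ac)
  finally show ?thesis .
qed

text \<open>The weight \<open>\<mu> y / s y\<close> now varies with the integration variable and
  cannot be pulled out. It cancels pointwise against the factor \<open>s y / \<mu> y\<close> of the
  jump rate, just as \<open>k / s0\<close> cancels at the source, which leaves \<open>c\<close>
  times the two sides of \<open>bal\<close>.\<close>

lemma balance_in_z:
  fixes t u \<mu> s :: "'z \<Rightarrow> real"
  assumes [measurable]: "t \<in> borel_measurable M" "u \<in> borel_measurable M"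
    and "0 < k" "0 < s0" "0 \<le> c"
    and \<mu>: "\<And>y. y \<in> space M \<Longrightarrow> 0 < \<mu> y" and s: "\<And>y. y \<in> space M \<Longrightarrow> 0 < s y"
    and bal: "(\<integral>\<^sup>+ y. ennreal (t y) \<partial>M) = (\<integral>\<^sup>+ y. ennreal (u y) \<partial>M)"
  shows "ennreal (c * (k / s0)) * (\<integral>\<^sup>+ y. ennreal (s0 * (t y / k)) \<partial>M)
    = (\<integral>\<^sup>+ y. ennreal (c * (\<mu> y / s y) * (s y * (u y / \<mu> y))) \<partial>M)"
proof -
  have "ennreal (c * (k / s0)) * (\<integral>\<^sup>+ y. ennreal (s0 * (t y / k)) \<partial>M)
      = (\<integral>\<^sup>+ y. ennreal c * ennreal (t y) \<partial>M)"
    using assms(3-5)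
    by (subst nn_integral_cmult[symmetric])
       (auto intro!: nn_integral_cong simp flip: ennreal_mult')
  also have "\<dots> = (\<integral>\<^sup>+ y. ennreal c * ennreal (u y) \<partial>M)"
    by (simp add: nn_integral_cmult bal)
  also have "\<dots> = (\<integral>\<^sup>+ y. ennreal (c * (\<mu> y / s y) * (s y * (u y / \<mu> y))) \<partial>M)"
  proof (intro nn_integral_cong)
    fix y assume "y \<in> space M"
    then show "ennreal c * ennreal (u y) = ennreal (c * (\<mu> y / s y) * (s y * (u y / \<mu> y)))"
      using \<mu>[of y] s[of y] \<open>0 \<le> c\<close> by (simp flip: ennreal_mult')
  qed
  finally show ?thesis .
qed

theorem theorem4p1:
  fixes \<upsilon> :: "'z measure" and \<gamma> :: "'x measure"
    and \<tau> :: "'x \<Rightarrow> 'z \<Rightarrow> 'z \<Rightarrow> real"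
    and Q :: "'z \<Rightarrow> 'x \<Rightarrow> 'x \<Rightarrow> real"
    and m :: "'z \<Rightarrow> 'x \<Rightarrow> real"
    and \<alpha> \<sigma> :: "'z \<Rightarrow> real"
  assumes "sigma_finite_measure \<upsilon>" and "emeasure \<upsilon> (space \<upsilon>) \<noteq> 0"
    and "sigma_finite_measure \<gamma>" and "emeasure \<gamma> (space \<gamma>) \<noteq> 0"
    and tau_measurable: "(\<lambda>(x, z, z'). \<tau> x z z') \<in> borel_measurable (\<gamma> \<Otimes>\<^sub>M \<upsilon> \<Otimes>\<^sub>M \<upsilon>)"
    and Q_measurable: "(\<lambda>(z, x, x'). Q z x x') \<in> borel_measurable (\<upsilon> \<Otimes>\<^sub>M \<gamma> \<Otimes>\<^sub>M \<gamma>)"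
    and m_measurable: "(\<lambda>(z, x). m z x) \<in> borel_measurable (\<upsilon> \<Otimes>\<^sub>M \<gamma>)"
    and alpha_measurable: "\<alpha> \<in> borel_measurable \<upsilon>"
    and sigma_measurable: "\<sigma> \<in> borel_measurable \<upsilon>"
    and tau_nonneg:
      "\<And>x z z'. x \<in> space \<gamma> \<Longrightarrow> z \<in> space \<upsilon> \<Longrightarrow> z' \<in> space \<upsilon> \<Longrightarrow> 0 \<le> \<tau> x z z'"
    and Q_nonneg:
      "\<And>z x x'. z \<in> space \<upsilon> \<Longrightarrow> x \<in> space \<gamma> \<Longrightarrow> x' \<in> space \<gamma> \<Longrightarrow> 0 \<le> Q z x x'"
    and m_pos: "\<And>z x. z \<in> space \<upsilon> \<Longrightarrow> x \<in> space \<gamma> \<Longrightarrow> 0 < m z x"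
    and alpha_nonneg: "\<And>z. z \<in> space \<upsilon> \<Longrightarrow> 0 \<le> \<alpha> z"
    and sigma_pos: "\<And>z. z \<in> space \<upsilon> \<Longrightarrow> 0 < \<sigma> z"
    and tau_diag: "\<And>x z. x \<in> space \<gamma> \<Longrightarrow> z \<in> space \<upsilon> \<Longrightarrow> \<tau> x z z = 0"
    and Q_diag: "\<And>z x. z \<in> space \<upsilon> \<Longrightarrow> x \<in> space \<gamma> \<Longrightarrow> Q z x x = 0"
    and tau_balance:
      "AE (z, x) in \<upsilon> \<Otimes>\<^sub>M \<gamma>.
         (\<integral>\<^sup>+ z'. ennreal (\<tau> x z z') \<partial>\<upsilon>) = (\<integral>\<^sup>+ z'. ennreal (\<tau> x z' z) \<partial>\<upsilon>)"
    and Q_invariance: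
      "AE (z, x) in \<upsilon> \<Otimes>\<^sub>M \<gamma>.
         ennreal (m z x) * (\<integral>\<^sup>+ y. ennreal (Q z x y) \<partial>\<gamma>)
         = (\<integral>\<^sup>+ y. ennreal (m z y * Q z y x) \<partial>\<gamma>)"
  shows "satisfies_WIE \<upsilon> \<gamma> (kappa m \<sigma>) (combined_rates \<tau> Q m \<alpha> \<sigma>) \<and>
    (Xi \<upsilon> \<gamma> m \<sigma> < \<infinity> \<longrightarrow>
       probability_density_on (\<upsilon> \<Otimes>\<^sub>M \<gamma>) (\<lambda>p. kappa m \<sigma> p / enn2real (Xi \<upsilon> \<gamma> m \<sigma>)) \<and>
       satisfies_WIE \<upsilon> \<gamma> (\<lambda>p. kappa m \<sigma> p / enn2real (Xi \<upsilon> \<gamma> m \<sigma>)) (combined_rates \<tau> Q m \<alpha> \<sigma>))"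
proof -
  interpret \<upsilon>: sigma_finite_measure \<upsilon> by fact
  interpret \<gamma>: sigma_finite_measure \<gamma> by fact
  note [measurable] = m_measurable alpha_measurable sigma_measurable
  let ?P = "\<upsilon> \<Otimes>\<^sub>M \<gamma>" and ?R = "combined_rates \<tau> Q m \<alpha> \<sigma>" and ?\<Xi> = "Xi \<upsilon> \<gamma> m \<sigma>"
  have [measurable]: "kappa m \<sigma> \<in> borel_measurable ?P"
    unfolding kappa_def by measurable
  have kappa_pos: "0 < kappa m \<sigma> p" if "p \<in> space ?P" for p
    using that m_pos sigma_pos by (auto simp: kappa_def space_pair_measure)
  \<comment> \<open>The WIE is homogeneous in the density, so one proof with a factor
    \<open>c\<close> serves both parts: \<open>c = 1\<close> for \<open>kappa\<close> itself and
    \<open>c = 1 / enn2real (Xi \<upsilon> \<gamma> m \<sigma>)\<close> for the normalized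
    density.\<close>
  have wie: "satisfies_WIE \<upsilon> \<gamma> (\<lambda>p. c * kappa m \<sigma> p) ?R" if c: "0 \<le> c" for c
    unfolding satisfies_WIE_def
  proof
    show "density_on ?P (\<lambda>p. c * kappa m \<sigma> p)"
      using c kappa_pos by (auto simp: density_on_def less_imp_le)
    show "AE (z, x) in ?P.
        ennreal (c * kappa m \<sigma> (z, x)) *
          ((\<integral>\<^sup>+ x'. ennreal (?R (z, x) (z, x')) \<partial>\<gamma>) + (\<integral>\<^sup>+ z'. ennreal (?R (z, x) (z', x)) \<partial>\<upsilon>))
        = (\<integral>\<^sup>+ x'. ennreal (c * kappa m \<sigma> (z, x') * ?R (z, x') (z, x)) \<partial>\<gamma>)
          + (\<integral>\<^sup>+ z'. ennreal (c * kappa m \<sigma> (z', x) * ?R (z', x) (z, x)) \<partial>\<upsilon>)"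
      using tau_balance Q_invariance AE_space
    proof eventually_elim
      case (elim p)
      obtain z x where p: "p = (z, x)" by (cases p)
      with elim have z [measurable]: "z \<in> space \<upsilon>" and x [measurable]: "x \<in> space \<gamma>"
        by (auto simp: space_pair_measure)
      \<comment> \<open>For \<open>v' = v\<close> the definition takes its first branch
        \<open>\<alpha> v * Q v x x\<close>. Both diagonals vanish, so the formula for
        \<open>z\<close>-jumps holds there as well.\<close>
      have R_z: "?R (v, x) (v', x) = \<sigma> v * (\<tau> x v v' / m v x)"
        if "v \<in> space \<upsilon>" "v' \<in> space \<upsilon>" for v v'
        using that x by (auto simp: combined_rates_def tau_diag Q_diag)
      have R_x: "?R (z, y) (z, y') = \<alpha> z * Q z y y'" for y y'
        by (simp add: combined_rates_def)
      \<comment> \<open>Sections of the jointly measurable kernels are compositions with the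
        embeddings that freeze the other coordinates at points of the spaces.\<close>
      have [measurable]: "(\<lambda>y. Q z x y) \<in> borel_measurable \<gamma>" "(\<lambda>y. Q z y x) \<in> borel_measurable \<gamma>"
        using measurable_compose[OF _ Q_measurable, of "\<lambda>y. (z, x, y)" \<gamma>]
          measurable_compose[OF _ Q_measurable, of "\<lambda>y. (z, y, x)" \<gamma>] by simp_all
      have [measurable]: "(\<lambda>v. \<tau> x z v) \<in> borel_measurable \<upsilon>" "(\<lambda>v. \<tau> x v z) \<in> borel_measurable \<upsilon>"
        using measurable_compose[OF _ tau_measurable, of "\<lambda>v. (x, z, v)" \<upsilon>]
          measurable_compose[OF _ tau_measurable, of "\<lambda>v. (x, v, z)" \<upsilon>] by simp_all
      have [measurable]: "(\<lambda>y. m z y) \<in> borel_measurable \<gamma>"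
        using measurable_compose[OF _ m_measurable, of "\<lambda>y. (z, y)" \<gamma>] by simp
      have "ennreal (c * (m z x / \<sigma> z)) * (\<integral>\<^sup>+ y. ennreal (\<alpha> z * Q z x y) \<partial>\<gamma>)
          = (\<integral>\<^sup>+ y. ennreal (c * (m z y / \<sigma> z) * (\<alpha> z * Q z y x)) \<partial>\<gamma>)"
        using elim z x c by (intro balance_in_x) (auto simp: p m_pos sigma_pos alpha_nonneg Q_nonneg)
      moreover have "ennreal (c * (m z x / \<sigma> z)) * (\<integral>\<^sup>+ v. ennreal (\<sigma> z * (\<tau> x z v / m z x)) \<partial>\<upsilon>)
          = (\<integral>\<^sup>+ v. ennreal (c * (m v x / \<sigma> v) * (\<sigma> v * (\<tau> x v z / m v x))) \<partial>\<upsilon>)"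
        using elim z x c by (intro balance_in_z) (auto simp: p m_pos sigma_pos)
      \<comment> \<open>\<open>R_z\<close> is conditional on membership in
        \<open>space \<upsilon>\<close>, so it is applied under the integral by congruence.
        \<open>R_x\<close> is unconditional and is left to the final simplification.\<close>
      moreover have "(\<integral>\<^sup>+ v. ennreal (?R (z, x) (v, x)) \<partial>\<upsilon>)
          = (\<integral>\<^sup>+ v. ennreal (\<sigma> z * (\<tau> x z v / m z x)) \<partial>\<upsilon>)"
        using z by (intro nn_integral_cong) (simp add: R_z)
      moreover have "(\<integral>\<^sup>+ v. ennreal (c * kappa m \<sigma> (v, x) * ?R (v, x) (z, x)) \<partial>\<upsilon>)
          = (\<integral>\<^sup>+ v. ennreal (c * (m v x / \<sigma> v) * (\<sigma> v * (\<tau> x v z / m v x))) \<partial>\<upsilon>)"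
        using z by (intro nn_integral_cong) (simp add: R_z kappa_def)
      \<comment> \<open>Distributing the density over the two outflow integrals turns the equation
        into the sum of the two separate balances.\<close>
      ultimately show ?case
        by (simp add: p R_x kappa_def distrib_left)
    qed
  qed
  have normalized: "probability_density_on ?P (\<lambda>p. kappa m \<sigma> p / enn2real ?\<Xi>)" if fin: "?\<Xi> < \<infinity>"
  proof -
    \<comment> \<open>A strictly positive function with integral zero would make the whole product
      space null, but its measure is the product of two nonzero numbers.\<close>
    have "?\<Xi> \<noteq> 0"
    proof
      assume "?\<Xi> = 0"
      then have "AE p in ?P. ennreal (kappa m \<sigma> p) = 0"
        by (simp add: Xi_def nn_integral_0_iff_AE)
      then have "AE p in ?P. False"
        using AE_space by eventually_elim (use kappa_pos in fastforce)
      then have "emeasure ?P (space ?P) = 0"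
        by (simp add: AE_iff_measurable[OF sets.top])
      then show False
        using assms(2,4) by (simp add: space_pair_measure \<gamma>.emeasure_pair_measure_Times)
    qed
    \<comment> \<open>Since the total mass is positive and finite, passing to
      \<open>enn2real\<close> loses nothing, and the real quotient in the integrand agrees with the
      quotient in \<open>ennreal\<close>.\<close>
    with fin have \<Xi>: "0 < enn2real ?\<Xi>" "ennreal (enn2real ?\<Xi>) = ?\<Xi>"
      by (auto simp: enn2real_positive_iff less_top zero_less_iff_neq_zero)
    have "(\<integral>\<^sup>+ p. ennreal (kappa m \<sigma> p / enn2real ?\<Xi>) \<partial>?P)
        = (\<integral>\<^sup>+ p. ennreal (kappa m \<sigma> p) / ?\<Xi> \<partial>?P)"
      using \<Xi> kappa_pos by (intro nn_integral_cong) (metis divide_ennreal less_imp_le)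
    also have "\<dots> = ?\<Xi> / ?\<Xi>"
      by (simp add: nn_integral_divide flip: Xi_def)
    also have "\<dots> = 1"
      using fin \<open>?\<Xi> \<noteq> 0\<close> by simp
    finally show ?thesis
      using kappa_pos
      by (auto simp: probability_density_on_def density_on_def less_imp_le)
  qed
  show ?thesis
    using wie[of 1] wie[of "1 / enn2real ?\<Xi>"] normalized by simp
qed

end
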